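(* Let $n \geq 2$ be a fixed integer, and for each integer $k \geq 0$ let $G_k := KG(2n+k,n)$ be the Kneser graph. Then $$\varphi(G_k) \leq (1+o(1))\,\frac{|V(G_k)|}{3},$$ where the $o(1)$ term tends to zero as $k \to \infty$ (with $n$ fixed). That is, for every fixed integer $n \geq 2$ there exists a function $\varepsilon_n : \mathbb{Z}_{\geq 0} \to \mathbb{R}$ with $\lim_{k\to\infty} \varepsilon_n(k) = 0$ such that $\varphi(G_k) \leq (1+\varepsilon_n(k))\,\frac{|V(G_k)|}{3}$ for all integers $k \geq 0$.
   Context: All graphs are simple, with nonempty finite vertex sets. Coloring: a coloring of a graph $G$ is a function $f : V(G) \to C$ such that for each $c \in C$ the set $f^{-1}(c)$ is independent; the elements of $C$ are called colors, and $f^{-1}(c)$ is called a color class of $f$. Color-dominating vertex: given a coloring $f : V(G) \to C$, a vertex $v$ is color-dominating with respect to $f$ if $f(N[v]) = C$, where $N[v]$ is the closed neighborhood of $v$ (that is, $v$ together with all its neighbors). b-coloring: a coloring $f : V(G) \to C$ is a b-coloring if each of its color classes $f^{-1}(c)$, $c \in C$, contains at least one color-dominating vertex. b-chromatic number: $\varphi(G)$ is the maximum positive integer $k$ for which $G$ admits a b-coloring $f : V(G) \to C$ with $|C| = k$. Kneser graph: for positive integers $N \geq m$, $KG(N,m)$ is the graph whose vertices are all $m$-element subsets of $\{1,2,\ldots,N\}$, two vertices $A$ and $B$ being adjacent if and only if $A \cap B = \varnothing$. In particular $|V(KG(2n+k,n))| = \binom{2n+k}{n}$. *)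

theory Defs
  imports Complex_Main "HOL-Library.FuncSet" "Graph_Theory.Pair_Digraph"
begin

text \<open>
  A simple graph with finite nonempty vertex set is a \<open>'a pair_pre_digraph\<close> \<open>G\<close> with
  \<open>pair_graph G\<close> (finite, loop-free, symmetric) and \<open>pverts G \<noteq> {}\<close>;
  an undirected edge is the pair of its two orientations.
\<close>

definition independent_set :: "'a pair_pre_digraph \<Rightarrow> 'a set \<Rightarrow> bool" where
  "independent_set G S \<longleftrightarrow> S \<subseteq> pverts G \<and> (\<forall>u\<in>S. \<forall>v\<in>S. (u, v) \<notin> parcs G)"

definition color_class :: "'a pair_pre_digraph \<Rightarrow> ('a \<Rightarrow> 'c) \<Rightarrow> 'c \<Rightarrow> 'a set" where
  "color_class G f c = {v \<in> pverts G. f v = c}"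

definition coloring :: "'a pair_pre_digraph \<Rightarrow> 'c set \<Rightarrow> ('a \<Rightarrow> 'c) \<Rightarrow> bool" where
  "coloring G C f \<longleftrightarrow> f \<in> pverts G \<rightarrow> C \<and> (\<forall>c\<in>C. independent_set G (color_class G f c))"

definition closed_neighborhood :: "'a pair_pre_digraph \<Rightarrow> 'a \<Rightarrow> 'a set" where
  "closed_neighborhood G v = insert v {w \<in> pverts G. (v, w) \<in> parcs G}"

definition color_dominating ::
    "'a pair_pre_digraph \<Rightarrow> 'c set \<Rightarrow> ('a \<Rightarrow> 'c) \<Rightarrow> 'a \<Rightarrow> bool" where
  "color_dominating G C f v \<longleftrightarrow> v \<in> pverts G \<and> f ` closed_neighborhood G v = C"

definition b_coloring :: "'a pair_pre_digraph \<Rightarrow> 'c set \<Rightarrow> ('a \<Rightarrow> 'c) \<Rightarrow> bool" where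
  "b_coloring G C f \<longleftrightarrow>
     coloring G C f \<and> (\<forall>c\<in>C. \<exists>v\<in>color_class G f c. color_dominating G C f v)"

text \<open>
  Colors are natural numbers here, which loses no generality: see
  \<open>b_coloring_card_le_b_chromatic_number\<close> below for colors of an arbitrary type. That the
  maximum exists is shown in \<open>finite_b_coloring_numbers\<close> and \<open>b_coloring_numbers_nonempty\<close>.
\<close>

definition b_coloring_numbers :: "'a pair_pre_digraph \<Rightarrow> nat set" where
  "b_coloring_numbers G =
     {k. k > 0 \<and> (\<exists>(C :: nat set) f. finite C \<and> card C = k \<and> b_coloring G C f)}"

definition b_chromatic_number :: "'a pair_pre_digraph \<Rightarrow> nat" where
  "b_chromatic_number G = Max (b_coloring_numbers G)"

text \<open>For \<open>m = 0\<close> the only vertex would carry a loop, hence the restriction \<open>m > 0\<close> below.\<close>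

definition kneser_graph :: "nat \<Rightarrow> nat \<Rightarrow> nat set pair_pre_digraph" where
  "kneser_graph N m =
     \<lparr>pverts = {A. A \<subseteq> {1..N} \<and> card A = m},
      parcs = {(A, B). A \<subseteq> {1..N} \<and> card A = m \<and> B \<subseteq> {1..N} \<and> card B = m \<and> A \<inter> B = {}}\<rparr>"

lemma card_pverts_kneser_graph: "card (pverts (kneser_graph N m)) = N choose m"
  using n_subsets[of "{1..N}" m] by (simp add: kneser_graph_def)

lemma pverts_kneser_graph_nonempty:
  assumes "m \<le> N"
  shows "pverts (kneser_graph N m) \<noteq> {}"
proof
  assume "pverts (kneser_graph N m) = {}"
  then have "N choose m = 0"
    using card_pverts_kneser_graph[of N m] by simp
  with assms show False
    by simp
qed

lemma pair_graph_kneser_graph: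
  assumes "m > 0"
  shows "pair_graph (kneser_graph N m)"
proof -
  let ?G = "kneser_graph N m"
  have parcs: "e \<in> parcs ?G \<longleftrightarrow> fst e \<in> pverts ?G \<and> snd e \<in> pverts ?G \<and> fst e \<inter> snd e = {}" for e
    by (cases e) (simp add: kneser_graph_def)
  have "pverts ?G \<subseteq> Pow {1..N}"
    unfolding kneser_graph_def by (simp add: subset_iff)
  then have fin: "finite (pverts ?G)"
    by (rule finite_subset) simp
  have "parcs ?G \<subseteq> pverts ?G \<times> pverts ?G"
    using parcs by (simp add: subset_iff mem_Times_iff)
  then have fin': "finite (parcs ?G)"
    by (rule finite_subset) (simp add: fin)
  have ne: "{} \<notin> pverts ?G"
    using assms by (simp add: kneser_graph_def)
  show ?thesis
  proof unfold_locales
    fix e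
    assume e: "e \<in> parcs ?G"
    show "fst e \<in> pverts ?G" "snd e \<in> pverts ?G"
      using e parcs by blast+
    show "fst e \<noteq> snd e"
      using e parcs[of e] ne by (metis Int_absorb)
  next
    show "symmetric (with_proj ?G)"
      unfolding symmetric_def with_proj_simps
    proof (rule symI)
      fix A B
      assume "(A, B) \<in> parcs ?G"
      then show "(B, A) \<in> parcs ?G"
        unfolding parcs fst_conv snd_conv by (simp add: Int_commute)
    qed
  qed (fact fin fin')+
qed

lemma b_coloring_subset_image:
  assumes "b_coloring G C f"
  shows "C \<subseteq> f ` pverts G"
proof
  fix c
  assume "c \<in> C"
  with assms obtain v where "v \<in> color_class G f c"
    unfolding b_coloring_def by blast
  then show "c \<in> f ` pverts G"
    unfolding color_class_def by blast
qed

lemma finite_b_coloring_numbers: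
  assumes "pair_graph G"
  shows "finite (b_coloring_numbers G)"
proof -
  interpret pair_graph G by fact
  have "k \<le> card (pverts G)" if "k \<in> b_coloring_numbers G" for k
  proof -
    from that obtain C :: "nat set" and f where C: "card C = k" "b_coloring G C f"
      by (auto simp: b_coloring_numbers_def)
    then have "C \<subseteq> f ` pverts G"
      by (intro b_coloring_subset_image)
    then have "card C \<le> card (f ` pverts G)"
      by (intro card_mono) auto
    also have "\<dots> \<le> card (pverts G)"
      by (intro card_image_le) auto
    finally show ?thesis
      using C by simp
  qed
  then have "b_coloring_numbers G \<subseteq> {..card (pverts G)}"
    by blast
  then show ?thesis
    by (rule finite_subset) simp
qed

lemma b_coloring_numbers_nonempty:
  assumes "pair_graph G" and ne: "pverts G \<noteq> {}"
  shows "b_coloring_numbers G \<noteq> {}"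
proof -
  interpret pair_graph G by fact
  define P where "P k \<longleftrightarrow> (\<exists>(C :: nat set) f. finite C \<and> card C = k \<and> coloring G C f)" for k
  obtain h :: "'a \<Rightarrow> nat" where h: "inj_on h (pverts G)"
    using finite_imp_inj_to_nat_seg[OF pair_finite_verts] by blast
  have noloop: "(v, v) \<notin> parcs G" for v
    using pair_no_loops[of "(v, v)"] by auto
  have "coloring G (h ` pverts G) h"
    using h noloop unfolding coloring_def independent_set_def color_class_def inj_on_def
    by blast
  then have "P (card (h ` pverts G))"
    unfolding P_def by (intro exI[of _ "h ` pverts G"] exI[of _ h]) auto
  then have "P (LEAST k. P k)"
    by (rule LeastI)
  then obtain C :: "nat set" and f where C: "finite C" "card C = (LEAST k. P k)" "coloring G C f"
    by (auto simp: P_def)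
  have fC: "f v \<in> C" if "v \<in> pverts G" for v
    using C(3) that by (auto simp: coloring_def)
  have proper: "f u \<noteq> f v" if "(u, v) \<in> parcs G" for u v
  proof -
    from that have "u \<in> pverts G" "v \<in> pverts G"
      using in_arcsD1 in_arcsD2 by auto
    with C(3) fC that show ?thesis
      by (fastforce simp: coloring_def independent_set_def color_class_def)
  qed
  have sub: "f ` closed_neighborhood G v \<subseteq> C" if "v \<in> pverts G" for v
    using that fC by (auto simp: closed_neighborhood_def)
  have "\<exists>v\<in>color_class G f c. color_dominating G C f v" if c: "c \<in> C" for c
  proof (rule ccontr)
    assume no: "\<not> ?thesis"
    have "\<exists>d. d \<in> C \<and> d \<notin> f ` closed_neighborhood G v" if "v \<in> pverts G" "f v = c" for v
      using no that sub[of v] by (auto simp: color_class_def color_dominating_def)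
    then obtain g where g: "\<And>v. v \<in> pverts G \<Longrightarrow> f v = c \<Longrightarrow>
        g v \<in> C \<and> g v \<notin> f ` closed_neighborhood G v"
      by metis
    define f' where "f' v = (if f v = c then g v else f v)" for v
    have gc: "g v \<in> C - {c}" if "v \<in> pverts G" "f v = c" for v
      using g[OF that] that by (auto simp: closed_neighborhood_def)
    have gn: "g u \<noteq> f v" if "(u, v) \<in> parcs G" "f u = c" for u v
    proof -
      from that(1) have "u \<in> pverts G" "v \<in> pverts G"
        using in_arcsD1 in_arcsD2 by auto
      with g[of u] that show ?thesis
        by (auto simp: closed_neighborhood_def)
    qed
    have "f' u \<noteq> f' v" if e: "(u, v) \<in> parcs G" for u v
      using gn[of u v] gn[of v u] proper[OF e] e arcs_symmetric[OF e]
      by (auto simp: f'_def)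
    moreover have "f' v \<in> C - {c}" if "v \<in> pverts G" for v
      using gc[OF that] fC[OF that] by (auto simp: f'_def)
    ultimately have "coloring G (C - {c}) f'"
      unfolding coloring_def independent_set_def color_class_def by fastforce
    then have "P (card (C - {c}))"
      using C(1) unfolding P_def by (intro exI[of _ "C - {c}"] exI[of _ f']) auto
    then have "card C \<le> card (C - {c})"
      using C(2) by (simp add: Least_le)
    with c C(1) show False
      by (meson card_Diff1_less not_le)
  qed
  with C have "b_coloring G C f"
    by (auto simp: b_coloring_def)
  moreover have "card C > 0"
    using ne fC C(1) by (auto simp: card_gt_0_iff)
  ultimately have "card C \<in> b_coloring_numbers G"
    using C(1) by (auto simp: b_coloring_numbers_def)
  then show ?thesis
    by auto
qed

lemma b_coloring_card_le_b_chromatic_number: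
  fixes C :: "'c set"
  assumes "pair_graph G" and ne: "pverts G \<noteq> {}" and b: "b_coloring G C f"
  shows "card C \<le> b_chromatic_number G"
proof -
  interpret pair_graph G by fact
  have "C \<subseteq> f ` pverts G"
    using b by (rule b_coloring_subset_image)
  then have fin: "finite C"
    using pair_finite_verts by (meson finite_imageI finite_subset)
  then obtain h :: "'c \<Rightarrow> nat" where h: "inj_on h C"
    using finite_imp_inj_to_nat_seg[OF fin] by blast
  have fC: "f v \<in> C" if "v \<in> pverts G" for v
    using b that by (auto simp: b_coloring_def coloring_def)
  have cls: "color_class G (h \<circ> f) (h c) = color_class G f c" if "c \<in> C" for c
    using h fC that by (auto simp: color_class_def inj_on_def)
  have "coloring G (h ` C) (h \<circ> f)"
    using b fC cls by (auto simp: b_coloring_def coloring_def)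
  moreover have "color_dominating G (h ` C) (h \<circ> f) v" if "color_dominating G C f v" for v
    using that by (auto simp: color_dominating_def image_comp[symmetric])
  moreover have "\<exists>v\<in>color_class G f c. color_dominating G C f v" if "c \<in> C" for c
    using b that by (simp add: b_coloring_def)
  ultimately have "b_coloring G (h ` C) (h \<circ> f)"
    unfolding b_coloring_def by (metis cls imageE)
  moreover have "card C > 0"
    using ne fC fin by (auto simp: card_gt_0_iff)
  ultimately have "card C \<in> b_coloring_numbers G"
    using fin h unfolding b_coloring_numbers_def
    by (auto intro!: exI[of _ "h ` C"] exI[of _ "h \<circ> f"] simp: card_image)
  then show ?thesis
    unfolding b_chromatic_number_def
    using finite_b_coloring_numbers[OF assms(1)] by (intro Max_ge)
qed

end

theory Submission
  imports Defs "HOL-Real_Asymp.Real_Asymp"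
begin

text \<open>
  If all members of a color class share a point, then so do they with its dominating vertex, and
  hence every other class has a member avoiding that point. So distinct classes with a common
  point have distinct common points, and there are at most \<open>N\<close> such classes. Intersecting
  families with at most two members have a common point, hence all but \<open>N\<close> of the classes have
  at least three members, which gives \<open>\<phi> \<le> |V| / 3 + N\<close>; and \<open>N = o(|V|)\<close> because \<open>n \<ge> 2\<close>.
\<close>

lemma mem_parcs_kneser_graph:
  "(A, B) \<in> parcs (kneser_graph N m) \<longleftrightarrow>
     A \<in> pverts (kneser_graph N m) \<and> B \<in> pverts (kneser_graph N m) \<and> A \<inter> B = {}"
  by (auto simp: kneser_graph_def)

lemma pverts_kneser_graph_subset: "A \<in> pverts (kneser_graph N m) \<Longrightarrow> A \<subseteq> {1..N}"
  by (auto simp: kneser_graph_def)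

lemma finite_pverts_kneser_graph: "finite (pverts (kneser_graph N m))"
  by (rule finite_subset[of _ "Pow {1..N}"]) (auto simp: kneser_graph_def)

text \<open>Independence also rules out loops, so the members of \<open>S\<close> are nonempty as
  well as pairwise intersecting. This settles the singleton case, and with two members a single
  intersection remains to check.\<close>

lemma small_independent_set_common_point:
  assumes "independent_set (kneser_graph N m) S" "S \<noteq> {}" "card S \<le> 2" "finite S"
  shows "\<Inter>S \<noteq> {}"
proof -
  have meet: "A \<inter> B \<noteq> {}" if "A \<in> S" "B \<in> S" for A B
    using assms(1) that unfolding independent_set_def mem_parcs_kneser_graph by blast
  from assms have "card S = 1 \<or> card S = 2"
    by (metis One_nat_def Suc_1 card_gt_0_iff le_SucE le_zero_eq less_numeral_extra(3))
  then obtain A B where "S = {A, B}"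
    by (metis card_1_singletonE card_2_iff insert_absorb2)
  with meet[of A B] show ?thesis
    by simp
qed

lemma card_common_point_classes_le:
  assumes "b_coloring (kneser_graph N m) C f"
  shows "card {c \<in> C. \<Inter>(color_class (kneser_graph N m) f c) \<noteq> {}} \<le> N"
proof -
  let ?cls = "color_class (kneser_graph N m) f"
  let ?D = "{c \<in> C. \<Inter>(?cls c) \<noteq> {}}"
  define p where "p c = (SOME x. x \<in> \<Inter>(?cls c))" for c
  have p: "p c \<in> \<Inter>(?cls c)" if "c \<in> ?D" for c
    using that unfolding p_def some_in_eq by blast
  have dom: "\<exists>v \<in> ?cls c. color_dominating (kneser_graph N m) C f v" if "c \<in> ?D" for c
    using assms that by (auto simp: b_coloring_def)
  have "inj_on p ?D"
  proof (rule inj_onI, rule ccontr)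
    fix c d
    assume cd: "c \<in> ?D" "d \<in> ?D" "p c = p d" "c \<noteq> d"
    from dom[OF cd(1)] obtain v where v: "v \<in> ?cls c" "color_dominating (kneser_graph N m) C f v"
      by blast
    with cd(2) have "d \<in> f ` closed_neighborhood (kneser_graph N m) v"
      by (simp add: color_dominating_def)
    then obtain w where w: "w \<in> closed_neighborhood (kneser_graph N m) v" "f w = d"
      by blast
    \<comment> \<open>Since \<open>v\<close> and \<open>w\<close> have different colors,
      \<open>w\<close> is a genuine neighbor of \<open>v\<close>. Both would contain the point
      \<open>p c = p d\<close>, although they are disjoint.\<close>
    with v(1) cd(4) have "w \<in> ?cls d" "v \<inter> w = {}"
      by (auto simp: closed_neighborhood_def color_class_def mem_parcs_kneser_graph)
    with v(1) p[OF cd(1)] p[OF cd(2)] cd(3) show False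
      by auto
  qed
  \<comment> \<open>The dominating vertex makes the class nonempty, so a common point lies in some
    vertex; for an empty class the intersection would be \<open>UNIV\<close>.\<close>
  moreover have "p ` ?D \<subseteq> {1..N}"
  proof
    fix x
    assume "x \<in> p ` ?D"
    then obtain c where c: "c \<in> ?D" "x = p c"
      by blast
    with dom[OF c(1)] p[OF c(1)] show "x \<in> {1..N}"
      using pverts_kneser_graph_subset by (fastforce simp: color_class_def)
  qed
  ultimately show ?thesis
    using card_inj_on_le[of p ?D "{1..N}"] by simp
qed

text \<open>The factor 3 stays on the left so that no rounding from division on \<open>nat\<close>
  enters the count.\<close>

lemma b_coloring_kneser_graph_card_le:
  assumes b: "b_coloring (kneser_graph N m) C f" and fin: "finite C"
  shows "3 * card C \<le> (N choose m) + 3 * N"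
proof -
  let ?cls = "color_class (kneser_graph N m) f"
  let ?D = "{c \<in> C. \<Inter>(?cls c) \<noteq> {}}"
  have finc: "finite (?cls c)" for c
    by (auto simp: color_class_def finite_pverts_kneser_graph)
  have three: "3 \<le> card (?cls c)" if "c \<in> C - ?D" for c
  proof (rule ccontr)
    assume "\<not> ?thesis"
    moreover have "independent_set (kneser_graph N m) (?cls c)" "?cls c \<noteq> {}"
      using b that by (auto simp: b_coloring_def coloring_def)
    ultimately have "\<Inter>(?cls c) \<noteq> {}"
      using finc by (intro small_independent_set_common_point) auto
    with that show False
      by blast
  qed
  have "card C = card ?D + card (C - ?D)"
    using fin by (subst card_Un_disjoint[symmetric]) (auto intro: arg_cong[where f = card])
  then have "3 * card C \<le> 3 * N + 3 * card (C - ?D)"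
    using card_common_point_classes_le[OF b] by simp
  also have "3 * card (C - ?D) \<le> (\<Sum>c\<in>C - ?D. card (?cls c))"
    using sum_mono[of "C - ?D" "\<lambda>_. 3" "\<lambda>c. card (?cls c)"] three by simp
  also have "\<dots> = card (\<Union>c\<in>C - ?D. ?cls c)"
    using fin finc by (intro card_UN_disjoint[symmetric]) (auto simp: color_class_def)
  also have "\<dots> \<le> card (pverts (kneser_graph N m))"
    by (intro card_mono finite_pverts_kneser_graph) (auto simp: color_class_def)
  finally show ?thesis
    by (simp add: card_pverts_kneser_graph)
qed

lemma b_chromatic_number_kneser_graph_le:
  assumes "0 < m" "m \<le> N"
  shows "3 * b_chromatic_number (kneser_graph N m) \<le> (N choose m) + 3 * N"
proof -
  note G = pair_graph_kneser_graph[OF assms(1), of N]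
  \<comment> \<open>\<open>Max\<close> is known to be attained only on a finite nonempty set. Some
    b-coloring exists because a coloring with the fewest colors is one.\<close>
  have "b_chromatic_number (kneser_graph N m) \<in> b_coloring_numbers (kneser_graph N m)"
    unfolding b_chromatic_number_def
    by (rule Max_in[OF finite_b_coloring_numbers[OF G]
          b_coloring_numbers_nonempty[OF G pverts_kneser_graph_nonempty[OF assms(2)]]])
  then obtain C :: "nat set" and f where "finite C" "b_coloring (kneser_graph N m) C f"
      and card_C: "card C = b_chromatic_number (kneser_graph N m)"
    unfolding b_coloring_numbers_def by blast
  then show ?thesis
    using b_coloring_kneser_graph_card_le[of N m C f] unfolding card_C by blast
qed

theorem theorem2:
  fixes n :: nat
  assumes "n \<ge> 2"
  shows "\<exists>\<epsilon> :: nat \<Rightarrow> real. \<epsilon> \<longlonglongrightarrow> 0 \<and>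
    (\<forall>k. real (b_chromatic_number (kneser_graph (2 * n + k) n))
         \<le> (1 + \<epsilon> k) * (real (card (pverts (kneser_graph (2 * n + k) n))) / 3))"
proof (intro exI conjI allI)
  \<comment> \<open>With \<open>N = 2 * n + k\<close>, this is the error \<open>3 * N\<close>
    divided by \<open>N choose 2\<close>, that is, by \<open>N * (N - 1) / 2\<close>.\<close>
  show "(\<lambda>k. 6 / (real (2 * n + k) - 1)) \<longlonglongrightarrow> 0"
    by real_asymp
next
  fix k
  define N where "N = 2 * n + k"
  have N: "N \<ge> 4"
    using assms by (simp add: N_def)
  have "real N * (real N - 1) / 2 = real (N choose 2)"
    using N by (simp add: choose_two real_of_nat_div)
  \<comment> \<open>Binomial coefficients increase up to the middle of the row, and
    \<open>2 \<le> n\<close> with \<open>2 * n \<le> N\<close> keeps both indices in that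
    half.\<close>
  also have "\<dots> \<le> real (N choose n)"
    using assms by (intro of_nat_mono binomial_mono) (auto simp: N_def)
  finally have "3 * real N \<le> 6 / (real N - 1) * real (N choose n)"
    using N by (simp add: field_simps)
  moreover have "3 * b_chromatic_number (kneser_graph N n) \<le> (N choose n) + 3 * N"
    using assms by (intro b_chromatic_number_kneser_graph_le) (auto simp: N_def)
  then have "3 * real (b_chromatic_number (kneser_graph N n)) \<le> real (N choose n) + 3 * real N"
    by linarith
  ultimately have "real (b_chromatic_number (kneser_graph N n))
      \<le> (1 + 6 / (real N - 1)) * (real (card (pverts (kneser_graph N n))) / 3)"
    unfolding card_pverts_kneser_graph by argo
  then show "real (b_chromatic_number (kneser_graph (2 * n + k) n))
      \<le> (1 + 6 / (real (2 * n + k) - 1))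
        * (real (card (pverts (kneser_graph (2 * n + k) n))) / 3)"
    by (simp add: N_def)
qed

end
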